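(* Let $G=\mathbb{Z}_5\times\mathbb{Z}_3\times\mathbb{Z}_3$. Let $E_1$ be the $7\times 1$ array over $G$ all of whose entries are $(0,0,0)$, and let $E_2$ be the $7\times 7$ array over $G$ $$E_2=\left(\begin{array}{ccccccc} (2,2,1) & (3,1,1) & (4,1,2) & (4,0,1) & (0,1,1) & (0,2,1) & (3,2,2) \\ (1,2,1) & (4,2,2) & (1,2,0) & (4,1,0) & (3,1,1) & (3,0,0) & (2,1,2) \\ (4,1,1) & (2,2,1) & (3,2,0) & (1,2,0) & (2,1,0) & (1,0,0) & (3,2,1) \\ (0,1,0) & (2,1,1) & (4,0,0) & (0,0,2) & (4,2,2) & (3,2,2) & (1,2,2) \\ (3,1,2) & (2,1,0) & (0,2,2) & (4,2,1) & (0,2,1) & (2,0,1) & (1,1,2) \\ (2,1,1) & (1,2,2) & (3,0,1) & (2,0,1) & (1,0,0) & (4,2,1) & (1,1,0) \\ (0,0,0) & (0,0,0) & (0,0,0) & (0,0,0) & (0,0,0) & (0,0,0) & (0,0,0) \end{array}\right).$$ Let $E_3$ be the $7\times 7$ array over $G$ obtained from $E_2$ by interchanging rows $1$ and $6$, rows $2$ and $5$, and rows $3$ and $4$, leaving row $7$ unaltered. Let $$V=\big[(0,0,1),\,(0,2,0),\,(0,1,2),\,(0,2,1),\,(0,1,0),\,(0,0,2),\,(0,0,0)\big]^T .$$ Then the $7\times 45$ matrix whose columns are the vectors $c+aV$, where $c$ runs over the $15$ columns of $E=[E_1\,|\,E_2\,|\,E_3]$ and $a$ runs over $\mathbb{Z}_3$,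 is a $(45,7,1)$-difference matrix over $G$.
   Context: Let $G$ be a finite abelian group of order $n$, written additively, and let $k\ge 2$ be an integer. An $(n,k,1)$-difference matrix over $G$ is a $k\times n$ matrix $D=(d_{i,j})$ with entries from $G$ such that for any two distinct rows $s$ and $t$, the multiset of differences $\{d_{s,j}-d_{t,j} : 1\le j\le n\}$ contains each element of $G$ exactly once. Column vectors over $G$ are added entrywise, and for $a\in\mathbb{Z}_3$ the vector $aV$ is obtained by multiplying every entry of $V$ by $a$; this is well defined since every entry of $V$ has first coordinate $0$ and hence order dividing $3$. *)

theory Defs
  imports
    "Jordan_Normal_Form.Gauss_Jordan_Elimination"
    "HOL-Library.Numeral_Type"
    "HOL-Library.Product_Plus"
begin

text \<open>
  A finite abelian group, written additively, is a type of class
  \<^class>\<open>finite\<close> and \<^class>\<open>ab_group_add\<close>.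
  Row and column indices of matrices start at 0.
\<close>

definition difference_matrix ::
    "nat \<Rightarrow> nat \<Rightarrow> ('g :: {finite, ab_group_add}) mat \<Rightarrow> bool" where
  "difference_matrix n k D \<longleftrightarrow>
     CARD('g) = n \<and> 2 \<le> k \<and> D \<in> carrier_mat k n \<and>
     (\<forall>s<k. \<forall>t<k. s \<noteq> t \<longrightarrow>
        (\<forall>g. count {# D $$ (s, j) - D $$ (t, j). j \<in># mset_set {0..<n} #} g = 1))"

text \<open>
  For \<open>a\<close> in the integers modulo 3, the multiple \<open>a g\<close> is the \<open>m\<close>-fold sum
  \<open>g + \<dots> + g\<close>, where \<open>m\<close> is the representative of \<open>a\<close> in \<open>{0, 1, 2}\<close>; lemma
  \<open>z3_scale_of_nat\<close> shows that any other representative gives the same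
  result if the order of \<open>g\<close> divides 3.
\<close>

definition z3_scale :: "3 \<Rightarrow> 'g :: ab_group_add \<Rightarrow> 'g" where
  "z3_scale a g = (\<Sum>i<nat (Rep_bit1 a). g)"

lemma z3_scale_of_nat:
  fixes g :: "'g :: ab_group_add"
  assumes "g + g + g = 0"
  shows "z3_scale (of_nat m) g = (\<Sum>i<m. g)"
proof -
  have period: "(\<Sum>i<r + 3 * q. g) = (\<Sum>i<r. g)" for q r :: nat
  proof (induction q)
    case (Suc q)
    have "(\<Sum>i<r + 3 * Suc q. g) = (\<Sum>i<r + 3 * q. g) + (g + g + g)"
      by (simp add: numeral_3_eq_3 add.assoc)
    then show ?case using Suc assms by simp
  qed simp
  have "nat (Rep_bit1 (of_nat m :: 3)) = m mod 3"
    using bit1.Rep_Abs_mod[of "int m", where 'a = num1]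
    by (simp add: bit1.of_nat_eq nat_mod_distrib)
  then show ?thesis
    using period[of "m mod 3" "m div 3"] by (simp add: z3_scale_def)
qed

type_synonym G = "5 \<times> 3 \<times> 3"

definition E1 :: "G mat" where
  "E1 = mat 7 1 (\<lambda>_. (0, 0, 0))"

definition E2 :: "G mat" where
  "E2 = mat_of_rows_list 7
  [[(2, 2, 1), (3, 1, 1), (4, 1, 2), (4, 0, 1), (0, 1, 1), (0, 2, 1), (3, 2, 2)],
   [(1, 2, 1), (4, 2, 2), (1, 2, 0), (4, 1, 0), (3, 1, 1), (3, 0, 0), (2, 1, 2)],
   [(4, 1, 1), (2, 2, 1), (3, 2, 0), (1, 2, 0), (2, 1, 0), (1, 0, 0), (3, 2, 1)],
   [(0, 1, 0), (2, 1, 1), (4, 0, 0), (0, 0, 2), (4, 2, 2), (3, 2, 2), (1, 2, 2)],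
   [(3, 1, 2), (2, 1, 0), (0, 2, 2), (4, 2, 1), (0, 2, 1), (2, 0, 1), (1, 1, 2)],
   [(2, 1, 1), (1, 2, 2), (3, 0, 1), (2, 0, 1), (1, 0, 0), (4, 2, 1), (1, 1, 0)],
   [(0, 0, 0), (0, 0, 0), (0, 0, 0), (0, 0, 0), (0, 0, 0), (0, 0, 0), (0, 0, 0)]]"

definition E3 :: "G mat" where
  "E3 = swaprows 0 5 (swaprows 1 4 (swaprows 2 3 E2))"

definition E :: "G mat" where
  "E = mat_of_cols 7 (cols E1 @ cols E2 @ cols E3)"

definition V :: "G vec" where
  "V = vec_of_list
     [(0, 0, 1), (0, 2, 0), (0, 1, 2), (0, 2, 1), (0, 1, 0), (0, 0, 2), (0, 0, 0)]"

end

theory Submission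
  imports Defs
begin

text \<open>
  Fix two rows \<open>s \<noteq> t\<close>. The column \<open>c + a V\<close> contributes the difference
  \<open>(c\<^sub>s - c\<^sub>t) + a (V\<^sub>s - V\<^sub>t)\<close>. The entries of \<open>V\<close> are seven distinct elements of
  \<open>{0} \<times> \<int>\<^sub>3 \<times> \<int>\<^sub>3\<close>, so \<open>V\<^sub>s - V\<^sub>t = (0, w)\<close> with \<open>w \<noteq> 0\<close> generates a subgroup \<open>L\<close> of
  order 3, and each column \<open>c\<close> of \<open>E\<close> yields precisely one coset of \<open>L\<close>. There are
  15 cosets and 15 columns, so all that matters is that the differences
  \<open>c\<^sub>s - c\<^sub>t\<close> lie in distinct cosets.

  The cosets of \<open>L\<close> are told apart by the homomorphism
  \<open>(x, u) \<mapsto> (x, det(w, u))\<close> onto \<open>\<int>\<^sub>5 \<times> \<int>\<^sub>3\<close>, whose kernel is \<open>L\<close>. Thus the claim for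
  each pair of rows reduces to 15 explicit elements of \<open>\<int>\<^sub>5 \<times> \<int>\<^sub>3\<close> being distinct
  (\<open>distinct_coset_translates\<close>), which is a computation with residues
  (\<open>E_differences_separated\<close>). Only pairs with \<open>t < s\<close> need it, because exchanging the
  two rows negates all differences, and distinctness of the 45 differences
  suffices because the group has 45 elements (\<open>difference_matrix_mat_of_cols\<close>).
\<close>

section \<open>Difference matrices from distinct differences\<close>

text \<open>
  As there are as many columns as group elements, differences that do not repeat
  take every value; and negation is injective, so one order of the rows is enough.
\<close>
lemma difference_matrix_mat_of_cols:
  fixes cs :: "'g :: {finite, ab_group_add} vec list"
  assumes card: "CARD('g) = length cs" and k: "2 \<le> k"
    and dist: "\<And>s t. t < s \<Longrightarrow> s < k \<Longrightarrow> distinct (map (\<lambda>v. v $ s - v $ t) cs)"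
  shows "difference_matrix (length cs) k (mat_of_cols k cs)"
  unfolding difference_matrix_def
proof (intro conjI allI impI)
  fix s t and g :: 'g
  assume s: "s < k" and t: "t < k" and "s \<noteq> t"
  let ?ds = "map (\<lambda>v. v $ s - v $ t) cs"
  have dist': "distinct ?ds"
  proof (cases "t < s")
    case False
    with \<open>s \<noteq> t\<close> s t have "distinct (map uminus (map (\<lambda>v. v $ t - v $ s) cs))"
      by (subst distinct_map) (simp add: dist)
    then show ?thesis by (simp add: comp_def)
  qed (use dist s in simp)
  then have "card (set ?ds) = CARD('g)"
    by (simp add: distinct_card card del: set_map)
  then have "set ?ds = UNIV"
    by (intro card_subset_eq) simp_all
  with dist' have one: "count (mset ?ds) g = 1"
    by (subst (asm) distinct_count_atmost_1) simp
  have "{# mat_of_cols k cs $$ (s, j) - mat_of_cols k cs $$ (t, j). j \<in># mset_set {0..<length cs} #}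
      = {# cs ! j $ s - cs ! j $ t. j \<in># mset_set {0..<length cs} #}"
    by (intro image_mset_cong) (simp add: mat_of_cols_index s t)
  also have "\<dots> = mset (map (\<lambda>j. cs ! j $ s - cs ! j $ t) [0..<length cs])"
    by simp
  also have "map (\<lambda>j. cs ! j $ s - cs ! j $ t) [0..<length cs] = ?ds"
    by (rule nth_equalityI) simp_all
  finally show "count {# mat_of_cols k cs $$ (s, j) - mat_of_cols k cs $$ (t, j).
      j \<in># mset_set {0..<length cs} #} g = 1"
    using one by simp
qed (use card k in simp_all)

section \<open>Arithmetic modulo 3 and cosets of a line\<close>

definition det3 :: "3 \<times> 3 \<Rightarrow> 3 \<times> 3 \<Rightarrow> 3" where
  "det3 w u = fst w * snd u - snd w * fst u"

text \<open>
  Equations between residues are decided by passing to integer representatives,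
  which, unlike numerals of a residue type, have a normal form.
\<close>
context
  fixes x y :: "'a :: finite bit1"
begin

lemma Rep_bit1_mult: "Rep_bit1 (x * y) = (Rep_bit1 x * Rep_bit1 y) mod int CARD('a bit1)"
  by (simp add: bit1.mult_def[of x y] bit1.Rep_Abs_mod del: card_bit1)

lemma Rep_bit1_diff: "Rep_bit1 (x - y) = (Rep_bit1 x - Rep_bit1 y) mod int CARD('a bit1)"
  by (simp add: bit1.diff_def[of x y] bit1.Rep_Abs_mod del: card_bit1)

lemma Rep_bit1_minus: "Rep_bit1 (- x) = (- Rep_bit1 x) mod int CARD('a bit1)"
  by (simp add: bit1.minus_def[of x] bit1.Rep_Abs_mod del: card_bit1)

end

lemmas Rep_bit1_arith =
  bit1.Rep_inject_sym bit1.Rep_0 bit1.Rep_1 bit1.Rep_numeral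
  Rep_bit1_mult Rep_bit1_diff Rep_bit1_minus

lemma z3_cases: obtains "a = (0 :: 3)" | "a = 1" | "a = 2"
proof -
  have "Rep_bit1 a = 0 \<or> Rep_bit1 a = 1 \<or> Rep_bit1 a = 2"
    using bit1.Rep_less_n[of a] Rep_bit1[of a] by auto
  then show ?thesis
    using that by (auto simp: Rep_bit1_arith)
qed

lemma z3_scale_simps:
  "z3_scale 0 g = 0" "z3_scale 1 g = g" "z3_scale 2 g = g + g"
  by (simp_all add: z3_scale_def bit1.Rep_0 bit1.Rep_1 bit1.Rep_numeral numeral_2_eq_2)

lemma z3_scale_diff: "z3_scale a g - z3_scale a h = z3_scale a (g - h)"
  by (simp add: z3_scale_def sum_subtractf)

lemma z3_scale_z3:
  fixes a y z :: 3
  shows "z3_scale a (0 :: 'x::ab_group_add, y, z) = (0, a * y, a * z)"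
  by (rule z3_cases[of a]) (simp_all add: z3_scale_simps zero_prod_def)

lemma z3_cancel:
  fixes a b y :: 3
  assumes "a * y = b * y" "y \<noteq> 0"
  shows "a = b"
  using assms
  by (cases a rule: z3_cases; cases b rule: z3_cases; cases y rule: z3_cases)
    (simp_all add: Rep_bit1_arith)

text \<open>
  The determinant with \<open>w\<close> is constant on each line parallel to \<open>w\<close>, so a
  coincidence between two translates forces the base points to have the same
  image, hence to be equal; then the two multiples of \<open>w\<close> agree, and so do their
  coefficients because \<open>w\<close> has order 3.
\<close>
lemma distinct_coset_translates:
  fixes w :: "3 \<times> 3"
  assumes "w \<noteq> 0"
    and d: "distinct (map (\<lambda>(x, u). (x, det3 w u)) ds)"
  shows "distinct [d + z3_scale a (0 :: 'x :: ab_group_add, w). d \<leftarrow> ds, a \<leftarrow> [0, 1, 2]]"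
proof -
  obtain y z where w: "w = (y, z)" by fastforce
  let ?f = "\<lambda>(d, a). d + z3_scale a (0 :: 'x, w)"
  have inj: "inj_on ?f (set ds \<times> set [0, 1, 2])"
  proof (rule inj_onI)
    fix v v'
    assume v: "v \<in> set ds \<times> set [0, 1, 2]" "v' \<in> set ds \<times> set [0, 1, 2]" and eq: "?f v = ?f v'"
    obtain x p q a where v_eq: "v = ((x, p, q), a)" by (metis surj_pair)
    obtain x' p' q' b where v'_eq: "v' = ((x', p', q'), b)" by (metis surj_pair)
    have mem: "(x, p, q) \<in> set ds" "(x', p', q') \<in> set ds"
      using v unfolding v_eq v'_eq by blast+
    from eq have x: "x = x'" and p: "p + a * y = p' + b * y" and q: "q + a * z = q' + b * z"
      by (simp_all add: v_eq v'_eq w z3_scale_z3)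
    have "det3 w (p, q) = y * (q + a * z) - z * (p + a * y)"
      by (simp add: w det3_def algebra_simps)
    also have "\<dots> = det3 w (p', q')"
      by (simp add: w det3_def p q algebra_simps)
    finally have pq: "(x, p, q) = (x', p', q')"
      using inj_onD[OF conjunct2[OF d[unfolded distinct_map]] _ mem] x by simp
    with p q have "a * y = b * y" "a * z = b * z"
      by simp_all
    with \<open>w \<noteq> 0\<close> have "a = b"
      by (auto simp: w zero_prod_def dest: z3_cancel)
    then show "v = v'"
      using pq by (simp add: v_eq v'_eq)
  qed
  have "distinct [0, 1, 2 :: 3]"
    by (simp add: Rep_bit1_arith)
  then have "distinct (map ?f (List.product ds [0, 1, 2]))"
    using inj d by (simp only: distinct_map set_product distinct_product)
  then show ?thesis
    by (simp add: product_concat_map map_concat comp_def)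
qed

section \<open>The rows of the array\<close>

definition E2_row :: "nat \<Rightarrow> G list" where
  "E2_row s = map (\<lambda>j. E2 $$ (s, j)) [0..<7]"

text \<open>The permutation of the rows by which \<open>E\<^sub>3\<close> arises from \<open>E\<^sub>2\<close>.\<close>
definition mirror :: "nat \<Rightarrow> nat" where
  "mirror s = (if s < 6 then 5 - s else s)"

lemma E2_carrier: "E2 \<in> carrier_mat 7 7"
proof -
  have "mat_of_rows_list 7 rs \<in> carrier_mat 7 7" if "length rs = 7" for rs :: "G list list"
    using that by (simp add: mat_of_rows_list_def)
  then show ?thesis
    unfolding E2_def by simp
qed

lemma all_lt_7: "(\<forall>s<7. P s) \<longleftrightarrow> P 0 \<and> P 1 \<and> P 2 \<and> P 3 \<and> P 4 \<and> P 5 \<and> P (6::nat)"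
  by (simp add: numeral_eq_Suc All_less_Suc2)

lemma E3_index:
  assumes "s < 7" "j < 7"
  shows "E3 $$ (s, j) = E2 $$ (mirror s, j)"
proof -
  have "\<forall>s<7. E3 $$ (s, j) = E2 $$ (mirror s, j)"
    unfolding all_lt_7 using assms(2) E2_carrier
    by (auto simp: E3_def mirror_def)
  with assms(1) show ?thesis by blast
qed

text \<open>
  The index 1 is written \<^term>\<open>Suc 0\<close>, here and for \<open>V\<close>, since this is the form into
  which simplification brings it.
\<close>
lemma E2_row_eqs:
  "E2_row 0 = [(2, 2, 1), (3, 1, 1), (4, 1, 2), (4, 0, 1), (0, 1, 1), (0, 2, 1), (3, 2, 2)]"
  "E2_row (Suc 0) = [(1, 2, 1), (4, 2, 2), (1, 2, 0), (4, 1, 0), (3, 1, 1), (3, 0, 0), (2, 1, 2)]"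
  "E2_row 2 = [(4, 1, 1), (2, 2, 1), (3, 2, 0), (1, 2, 0), (2, 1, 0), (1, 0, 0), (3, 2, 1)]"
  "E2_row 3 = [(0, 1, 0), (2, 1, 1), (4, 0, 0), (0, 0, 2), (4, 2, 2), (3, 2, 2), (1, 2, 2)]"
  "E2_row 4 = [(3, 1, 2), (2, 1, 0), (0, 2, 2), (4, 2, 1), (0, 2, 1), (2, 0, 1), (1, 1, 2)]"
  "E2_row 5 = [(2, 1, 1), (1, 2, 2), (3, 0, 1), (2, 0, 1), (1, 0, 0), (4, 2, 1), (1, 1, 0)]"
  "E2_row 6 = [(0, 0, 0), (0, 0, 0), (0, 0, 0), (0, 0, 0), (0, 0, 0), (0, 0, 0), (0, 0, 0)]"
  by (simp_all add: E2_row_def E2_def mat_of_rows_list_def upt_conv_Cons)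

lemma map_cols_E_index:
  assumes "s < 7"
  shows "map (\<lambda>c. c $ s) (cols E) = 0 # E2_row s @ E2_row (mirror s)"
proof -
  have E3: "E3 \<in> carrier_mat 7 7"
    using E2_carrier by (simp add: E3_def)
  then have dim: "dim_row E1 = 7" "dim_row E2 = 7" "dim_row E3 = 7" "dim_col E2 = 7" "dim_col E3 = 7"
    using E2_carrier by (simp_all add: E1_def)
  then have "set (cols E1 @ cols E2 @ cols E3) \<subseteq> carrier_vec 7"
    using cols_dim[of E1] cols_dim[of E2] cols_dim[of E3] by simp
  then have "cols E = cols E1 @ cols E2 @ cols E3"
    unfolding E_def by (rule cols_mat_of_cols)
  moreover have "map (\<lambda>c. c $ s) (cols E1) = [0]"
    using assms by (simp add: cols_def E1_def zero_prod_def)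
  moreover have "map (\<lambda>c. c $ s) (cols E2) = E2_row s"
    using assms dim by (simp add: cols_def E2_row_def)
  moreover have "map (\<lambda>c. c $ s) (cols E3) = E2_row (mirror s)"
    using assms dim by (simp add: cols_def E2_row_def E3_index)
  ultimately show ?thesis
    by simp
qed

lemma V_nth:
  "V $ 0 = (0, 0, 1)" "V $ Suc 0 = (0, 2, 0)" "V $ 2 = (0, 1, 2)" "V $ 3 = (0, 2, 1)"
  "V $ 4 = (0, 1, 0)" "V $ 5 = (0, 0, 2)" "V $ 6 = (0, 0, 0)"
  by (simp_all add: V_def numeral_eq_Suc)

section \<open>Differences of two rows\<close>

text \<open>\<^typ>\<open>3\<close> is \<open>1 + 2 \<cdot> 1\<close> and \<^typ>\<open>5\<close> is \<open>1 + 2 \<cdot> 2\<close>, whence the instances.\<close>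
lemmas Rep_3 = Rep_bit1_arith(2-)[where 'a = num1, simplified]
lemmas Rep_5 = Rep_bit1_arith(2-)[where 'a = "num1 bit0", simplified]

lemma E_differences:
  assumes "s < 7" "t < 7"
  shows "map (\<lambda>c. c $ s - c $ t) (cols E)
    = map2 (-) (0 # E2_row s @ E2_row (mirror s)) (0 # E2_row t @ E2_row (mirror t))"
proof -
  have "map (\<lambda>c. c $ s - c $ t) (cols E)
      = map2 (-) (map (\<lambda>c. c $ s) (cols E)) (map (\<lambda>c. c $ t) (cols E))"
    by (intro nth_equalityI) simp_all
  with assms show ?thesis by (simp only: map_cols_E_index)
qed

text \<open>
  The finite computation. Representatives are taken inside the list so that
  simplification turns its 15 entries into integer numerals before it compares
  them pairwise.
\<close>
lemma E_differences_separated: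
  "\<forall>s<7. \<forall>t<7. t < s \<longrightarrow> fst (V $ s - V $ t) = 0 \<and> snd (V $ s - V $ t) \<noteq> 0 \<and>
    distinct (map (\<lambda>(x, u). (Rep_bit1 x, Rep_bit1 (det3 (snd (V $ s - V $ t)) u)))
      (map2 (-) (0 # E2_row s @ E2_row (mirror s)) (0 # E2_row t @ E2_row (mirror t))))"
  unfolding all_lt_7
  by (simp add: E2_row_eqs mirror_def zero_prod_def V_nth det3_def Rep_bit1_arith(1) Rep_3 Rep_5)

theorem mainTheorem5:
  fixes cs :: "G vec list"
  assumes "mset cs = mset [c + map_vec (z3_scale a) V. c \<leftarrow> cols E, a \<leftarrow> [0, 1, 2]]"
  shows "difference_matrix 45 7 (mat_of_cols 7 cs)"
proof -
  let ?vs = "[c + map_vec (z3_scale a) V. c \<leftarrow> cols E, a \<leftarrow> [0, 1, 2]]"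
  have "length (cols E) = length (map (\<lambda>c. c $ 0) (cols E))"
    by simp
  also have "\<dots> = 15"
    by (subst map_cols_E_index) (simp_all add: E2_row_def)
  finally have "length ?vs = 45"
    by (simp add: length_concat comp_def sum_list_triv)
  then have len: "length cs = 45"
    using assms by (metis size_mset)
  have "distinct (map (\<lambda>v. v $ s - v $ t) cs)" if "t < s" "s < 7" for s t
  proof -
    have st: "s < dim_vec V" "t < dim_vec V" "s < 7" "t < 7"
      using that by (simp_all add: V_def)
    let ?ds = "map (\<lambda>c. c $ s - c $ t) (cols E)" and ?w = "V $ s - V $ t"
    have "fst ?w = 0" "snd ?w \<noteq> 0"
      "distinct (map (\<lambda>(x, u). (Rep_bit1 x, Rep_bit1 (det3 (snd ?w) u))) ?ds)"
      using E_differences_separated that by (auto simp only: E_differences st)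
    moreover have "map (\<lambda>(x, u). (Rep_bit1 x, Rep_bit1 (det3 (snd ?w) u))) ?ds
        = map (map_prod Rep_bit1 Rep_bit1) (map (\<lambda>(x, u). (x, det3 (snd ?w) u)) ?ds)"
      by (simp add: case_prod_unfold)
    ultimately have "distinct (map (\<lambda>(x, u). (x, det3 (snd ?w) u)) ?ds)"
      using distinct_map[of "map_prod Rep_bit1 Rep_bit1" "map (\<lambda>(x, u). (x, det3 (snd ?w) u)) ?ds"]
      by argo
    with \<open>snd ?w \<noteq> 0\<close> have "distinct [d + z3_scale a (0, snd ?w). d \<leftarrow> ?ds, a \<leftarrow> [0, 1, 2]]"
      by (rule distinct_coset_translates)
    also have "(0, snd ?w) = ?w"
      using \<open>fst ?w = 0\<close> by (metis prod.collapse)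
    also have "[d + z3_scale a ?w. d \<leftarrow> ?ds, a \<leftarrow> [0, 1, 2]] = map (\<lambda>v. v $ s - v $ t) ?vs"
      using st by (simp add: map_concat comp_def add_diff_add z3_scale_diff)
    finally have "distinct (map (\<lambda>v. v $ s - v $ t) ?vs)" .
    moreover have "mset (map (\<lambda>v. v $ s - v $ t) cs) = mset (map (\<lambda>v. v $ s - v $ t) ?vs)"
      by (simp only: mset_map assms)
    ultimately show ?thesis
      using mset_eq_imp_distinct_iff by blast
  qed
  then have "difference_matrix (length cs) 7 (mat_of_cols 7 cs)"
    by (intro difference_matrix_mat_of_cols) (simp_all add: len)
  then show ?thesis by (simp only: len)
qed

end
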